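(* Fix $m,n\in\mathbb N$. Let $A=(a_{ij})$ be an $m\times m$ symmetric stochastic matrix and let $B=(b_{ij})$ be an $n\times n$ symmetric stochastic matrix. Then every kernel $K:X\times X\to[0,\infty)$ satisfies $$\gamma_+(A\otimes B,K)\le\gamma_+(A,K)\,\gamma_+(B,K).$$
   Context: A kernel on a set $X$ is a symmetric function $K:X\times X\to[0,\infty)$. For an $n\times n$ symmetric stochastic matrix $A=(a_{ij})$, $\gamma_+(A,K)\in[0,\infty]$ is the infimum over those $\gamma_+>0$ such that for all $x_1,\ldots,x_n,y_1,\ldots,y_n\in X$, $$\frac1{n^2}\sum_{i,j=1}^nK(x_i,y_j)\le\frac{\gamma_+}{n}\sum_{i,j=1}^na_{ij}K(x_i,y_j)$$ ($\infty$ if there is no finite such $\gamma_+$). $A\otimes B$ is the $(mn)\times(mn)$ Kronecker product, indexed by $\{1,\ldots,m\}\times\{1,\ldots,n\}$, with entry $a_{ij}b_{st}$ at $((i,s),(j,t))$. *)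

theory Defs
  imports "HOL-Analysis.Analysis"
begin

text \<open>Kernels are functions on the ambient type whose values matter only on the set \<open>X\<close>;
  \<open>X\<close> may be empty.\<close>

definition kernel_on :: "'a set \<Rightarrow> ('a \<Rightarrow> 'a \<Rightarrow> real) \<Rightarrow> bool" where
  "kernel_on X K \<longleftrightarrow> (\<forall>x\<in>X. \<forall>y\<in>X. 0 \<le> K x y \<and> K x y = K y x)"

definition symmetric_stochastic :: "real ^ 'n ^ 'n \<Rightarrow> bool" where
  "symmetric_stochastic A \<longleftrightarrow>
     transpose A = A \<and> (\<forall>i j. 0 \<le> A $ i $ j) \<and> (\<forall>i. (\<Sum>j\<in>UNIV. A $ i $ j) = 1)"

text \<open>The infimum is taken in \<open>[0,\<infinity>]\<close>, so it is \<open>\<infinity>\<close> when no real constant is admissible.\<close>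

definition gamma_plus :: "'a set \<Rightarrow> real ^ 'n ^ 'n \<Rightarrow> ('a \<Rightarrow> 'a \<Rightarrow> real) \<Rightarrow> ennreal" where
  "gamma_plus X A K = Inf (ennreal ` {\<gamma>. 0 < \<gamma> \<and>
     (\<forall>x y :: 'n \<Rightarrow> 'a. (\<forall>i. x i \<in> X) \<longrightarrow> (\<forall>j. y j \<in> X) \<longrightarrow>
        1 / (real CARD('n))\<^sup>2 * (\<Sum>i\<in>UNIV. \<Sum>j\<in>UNIV. K (x i) (y j))
        \<le> \<gamma> / real CARD('n) * (\<Sum>i\<in>UNIV. \<Sum>j\<in>UNIV. A $ i $ j * K (x i) (y j)))})"

definition kronecker :: "real ^ 'm ^ 'm \<Rightarrow> real ^ 'n ^ 'n \<Rightarrow> real ^ ('m \<times> 'n) ^ ('m \<times> 'n)" where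
  "kronecker A B = (\<chi> p q. A $ fst p $ fst q * B $ snd p $ snd q)"

end

theory Submission imports Defs begin

text \<open>If \<open>a\<close> and \<open>b\<close> are admissible for \<open>A\<close> and \<open>B\<close>, then \<open>a * b\<close> is admissible for the Kronecker
  product: apply the inequality for \<open>B\<close> in the second coordinates with the first ones fixed, and
  then the inequality for \<open>A\<close> in the first coordinates. Constant families show that an admissible
  constant is at least 1 unless \<open>K\<close> vanishes on \<open>X\<close>; this settles the degenerate product
  \<open>0 * \<infinity> = 0\<close>.\<close>

text \<open>Isolates the condition under the infimum, so that \<gamma>_+ becomes an indexed infimum
  and constants can be handled one at a time.\<close>

definition admissible :: "'a set \<Rightarrow> real ^ 'n ^ 'n \<Rightarrow> ('a \<Rightarrow> 'a \<Rightarrow> real) \<Rightarrow> real \<Rightarrow> bool" where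
  "admissible X A K \<gamma> \<longleftrightarrow> 0 < \<gamma> \<and>
     (\<forall>x y :: 'n \<Rightarrow> 'a. (\<forall>i. x i \<in> X) \<longrightarrow> (\<forall>j. y j \<in> X) \<longrightarrow>
        1 / (real CARD('n))\<^sup>2 * (\<Sum>i\<in>UNIV. \<Sum>j\<in>UNIV. K (x i) (y j))
        \<le> \<gamma> / real CARD('n) * (\<Sum>i\<in>UNIV. \<Sum>j\<in>UNIV. A $ i $ j * K (x i) (y j)))"

lemma gamma_plus_eq_INF: "gamma_plus X A K = (INF \<gamma>\<in>Collect (admissible X A K). ennreal \<gamma>)"
  by (simp add: gamma_plus_def admissible_def[abs_def])

lemma admissibleD:
  fixes A :: "real ^ 'n ^ 'n"
  assumes "admissible X A K \<gamma>" "\<And>i. x i \<in> X" "\<And>j. y j \<in> X"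
  shows "1 / (real CARD('n))\<^sup>2 * (\<Sum>i\<in>UNIV. \<Sum>j\<in>UNIV. K (x i) (y j))
    \<le> \<gamma> / real CARD('n) * (\<Sum>i\<in>UNIV. \<Sum>j\<in>UNIV. A $ i $ j * K (x i) (y j))"
  using assms by (simp add: admissible_def)

text \<open>The order \<open>i\<close>, \<open>j\<close>, \<open>s\<close>, \<open>t\<close> groups
  the two first coordinates and the two second ones, so each inner double sum has the shape to which
  admissibility applies.\<close>

lemma sum_UNIV_prod_prod:
  fixes f :: "'m::finite \<times> 'n::finite \<Rightarrow> 'm \<times> 'n \<Rightarrow> 'b::comm_monoid_add"
  shows "(\<Sum>p\<in>UNIV. \<Sum>q\<in>UNIV. f p q)
    = (\<Sum>i\<in>UNIV. \<Sum>j\<in>UNIV. \<Sum>s\<in>UNIV. \<Sum>t\<in>UNIV. f (i, s) (j, t))"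
proof -
  have sum_UNIV: "(\<Sum>p\<in>UNIV. g p) = (\<Sum>i\<in>UNIV. \<Sum>s\<in>UNIV. g (i, s))" for g :: "'m \<times> 'n \<Rightarrow> 'b"
    by (simp add: sum.cartesian_product)
  show ?thesis
    unfolding sum_UNIV by (rule sum.cong[OF refl], rule sum.swap)
qed

lemma sum_swap_pairs:
  "(\<Sum>i\<in>I. \<Sum>j\<in>J. \<Sum>s\<in>S. \<Sum>t\<in>T. f i j s t) = (\<Sum>s\<in>S. \<Sum>t\<in>T. \<Sum>i\<in>I. \<Sum>j\<in>J. f i j s t)"
proof -
  have "(\<Sum>i\<in>I. \<Sum>j\<in>J. \<Sum>s\<in>S. \<Sum>t\<in>T. f i j s t)
      = (\<Sum>(i, j)\<in>I \<times> J. \<Sum>(s, t)\<in>S \<times> T. f i j s t)"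
    by (simp only: sum.cartesian_product[symmetric])
  also have "\<dots> = (\<Sum>(s, t)\<in>S \<times> T. \<Sum>(i, j)\<in>I \<times> J. f i j s t)"
    unfolding case_prod_beta by (rule sum.swap)
  also have "\<dots> = (\<Sum>s\<in>S. \<Sum>t\<in>T. \<Sum>i\<in>I. \<Sum>j\<in>J. f i j s t)"
    by (simp only: sum.cartesian_product[symmetric])
  finally show ?thesis .
qed

lemma admissible_kronecker:
  fixes A :: "real ^ 'm ^ 'm" and B :: "real ^ 'n ^ 'n"
  assumes A: "admissible X A K a" and B: "admissible X B K b"
    and nonneg: "\<And>s t. 0 \<le> B $ s $ t"
  shows "admissible X (kronecker A B) K (a * b)"
  unfolding admissible_def
proof (intro conjI allI impI)
  have a: "0 < a" and b: "0 < b"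
    using A B by (auto simp: admissible_def)
  then show "0 < a * b" by simp
  fix x y :: "'m \<times> 'n \<Rightarrow> 'a"
  assume x: "\<forall>p. x p \<in> X" and y: "\<forall>q. y q \<in> X"
  define k where "k i j s t = K (x (i, s)) (y (j, t))" for i j s t
  define M where "M = real CARD('m)"
  define N where "N = real CARD('n)"
  have M: "0 < M" and N: "0 < N" by (auto simp: M_def N_def)
  have leB: "1 / N\<^sup>2 * (\<Sum>s\<in>UNIV. \<Sum>t\<in>UNIV. k i j s t)
      \<le> b / N * (\<Sum>s\<in>UNIV. \<Sum>t\<in>UNIV. B $ s $ t * k i j s t)" for i j
    using admissibleD[OF B, of "\<lambda>s. x (i, s)" "\<lambda>t. y (j, t)"] x y by (simp add: k_def N_def)
  have leA: "1 / M\<^sup>2 * (\<Sum>i\<in>UNIV. \<Sum>j\<in>UNIV. k i j s t)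
      \<le> a / M * (\<Sum>i\<in>UNIV. \<Sum>j\<in>UNIV. A $ i $ j * k i j s t)" for s t
    using admissibleD[OF A, of "\<lambda>i. x (i, s)" "\<lambda>j. y (j, t)"] x y by (simp add: k_def M_def)
  have "1 / (M * N)\<^sup>2 * (\<Sum>i\<in>UNIV. \<Sum>j\<in>UNIV. \<Sum>s\<in>UNIV. \<Sum>t\<in>UNIV. k i j s t)
      = 1 / M\<^sup>2 * (\<Sum>i\<in>UNIV. \<Sum>j\<in>UNIV. 1 / N\<^sup>2 * (\<Sum>s\<in>UNIV. \<Sum>t\<in>UNIV. k i j s t))"
    by (simp add: sum_divide_distrib power_mult_distrib mult.commute)
  also have "\<dots> \<le> 1 / M\<^sup>2 * (\<Sum>i\<in>UNIV. \<Sum>j\<in>UNIV. b / N * (\<Sum>s\<in>UNIV. \<Sum>t\<in>UNIV. B $ s $ t * k i j s t))"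
    by (intro mult_left_mono sum_mono leB) simp
  also have "\<dots> = b / N * (1 / M\<^sup>2 * (\<Sum>i\<in>UNIV. \<Sum>j\<in>UNIV. \<Sum>s\<in>UNIV. \<Sum>t\<in>UNIV. B $ s $ t * k i j s t))"
    by (simp only: sum_distrib_left[symmetric] mult.left_commute)
  \<comment> \<open>With the sums over \<open>i\<close> and \<open>j\<close> innermost,
    \<open>leA\<close> becomes applicable for each fixed \<open>s\<close> and
    \<open>t\<close>.\<close>
  also have "(\<Sum>i\<in>UNIV. \<Sum>j\<in>UNIV. \<Sum>s\<in>UNIV. \<Sum>t\<in>UNIV. B $ s $ t * k i j s t)
      = (\<Sum>s\<in>UNIV. \<Sum>t\<in>UNIV. \<Sum>i\<in>UNIV. \<Sum>j\<in>UNIV. B $ s $ t * k i j s t)"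
    by (rule sum_swap_pairs)
  also have "1 / M\<^sup>2 * \<dots>
      = (\<Sum>s\<in>UNIV. \<Sum>t\<in>UNIV. B $ s $ t * (1 / M\<^sup>2 * (\<Sum>i\<in>UNIV. \<Sum>j\<in>UNIV. k i j s t)))"
    by (simp only: sum_distrib_left mult.left_commute)
  \<comment> \<open>The weights \<open>B $ s $ t\<close> are nonnegative, so \<open>leA\<close> may
    be used termwise under them.\<close>
  also have "b / N * \<dots> \<le> b / N *
      (\<Sum>s\<in>UNIV. \<Sum>t\<in>UNIV. B $ s $ t * (a / M * (\<Sum>i\<in>UNIV. \<Sum>j\<in>UNIV. A $ i $ j * k i j s t)))"
    using b N by (intro mult_left_mono sum_mono leA nonneg) simp
  also have "\<dots> = a * b / (M * N) *
      (\<Sum>s\<in>UNIV. \<Sum>t\<in>UNIV. \<Sum>i\<in>UNIV. \<Sum>j\<in>UNIV. A $ i $ j * B $ s $ t * k i j s t)"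
    by (simp add: sum_distrib_left mult_ac)
  also have "(\<Sum>s\<in>UNIV. \<Sum>t\<in>UNIV. \<Sum>i\<in>UNIV. \<Sum>j\<in>UNIV. A $ i $ j * B $ s $ t * k i j s t)
      = (\<Sum>i\<in>UNIV. \<Sum>j\<in>UNIV. \<Sum>s\<in>UNIV. \<Sum>t\<in>UNIV. A $ i $ j * B $ s $ t * k i j s t)"
    by (rule sum_swap_pairs)
  finally show "1 / (real CARD('m \<times> 'n))\<^sup>2 * (\<Sum>p\<in>UNIV. \<Sum>q\<in>UNIV. K (x p) (y q))
      \<le> a * b / real CARD('m \<times> 'n) * (\<Sum>p\<in>UNIV. \<Sum>q\<in>UNIV. kronecker A B $ p $ q * K (x p) (y q))"
    unfolding sum_UNIV_prod_prod
    by (simp add: kronecker_def k_def M_def N_def)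
qed

text \<open>For constant families the left side is \<open>K x y\<close>. The row sums being 1, the
  entries of \<open>A\<close> add up to the dimension, so the right side is
  \<open>\<gamma> * K x y\<close>; cancel \<open>K x y\<close>.\<close>

lemma admissible_ge_1:
  fixes A :: "real ^ 'n ^ 'n"
  assumes A: "admissible X A K \<gamma>" and row: "\<And>i. (\<Sum>j\<in>UNIV. A $ i $ j) = 1"
    and "x \<in> X" "y \<in> X" "0 < K x y"
  shows "1 \<le> \<gamma>"
  using admissibleD[OF A, of "\<lambda>_. x" "\<lambda>_. y"] assms(3-)
  by (simp add: row power2_eq_square flip: sum_distrib_right)

text \<open>The bound on each admissible constant passes to the infimum, which is \<infinity> if
  there is no such constant.\<close>

lemma gamma_plus_ge_1:
  assumes "symmetric_stochastic A" "x \<in> X" "y \<in> X" "0 < K x y"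
  shows "1 \<le> gamma_plus X A K"
  unfolding gamma_plus_eq_INF
  using assms admissible_ge_1[of X A K _ x y]
  by (auto intro!: INF_greatest simp: symmetric_stochastic_def)

text \<open>Every positive constant is admissible. The value 0 itself is excluded, so the infimum is
  reached only in the limit.\<close>

lemma gamma_plus_eq_0:
  assumes "\<And>x y. x \<in> X \<Longrightarrow> y \<in> X \<Longrightarrow> K x y = 0"
  shows "gamma_plus X A K = 0"
proof -
  have "admissible X A K \<gamma>" if "0 < \<gamma>" for \<gamma>
    using that by (simp add: admissible_def assms)
  then have "gamma_plus X A K \<le> 0 + ennreal \<gamma>" if "0 < \<gamma>" for \<gamma>
    using that unfolding gamma_plus_eq_INF by (auto intro!: INF_lower)
  then have "gamma_plus X A K \<le> 0"
    by (rule ennreal_le_epsilon)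
  then show ?thesis by simp
qed

text \<open>For finite \<open>u\<close>, divide by \<open>u\<close>, pass to the infimum and
  multiply back. For infinite \<open>u\<close>, positivity of the infimum makes the right side
  \<infinity>.\<close>

lemma le_mult_INF_ennreal:
  fixes g :: "'b \<Rightarrow> ennreal"
  assumes le: "\<And>b. b \<in> T \<Longrightarrow> c \<le> u * g b" and u: "0 < u" and pos: "0 < (INF b\<in>T. g b)"
  shows "c \<le> u * (INF b\<in>T. g b)"
proof (cases "u = top")
  case True
  then show ?thesis using pos by (simp add: ennreal_top_mult)
next
  case False
  have "c / u \<le> (INF b\<in>T. g b)"
    using le u by (auto intro!: INF_greatest divide_le_posI_ennreal)
  then have "u * (c / u) \<le> u * (INF b\<in>T. g b)"
    by (rule mult_left_mono) simp
  moreover have "u * (c / u) = c"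
    using u False mult_divide_eq_ennreal[of u c] by (simp add: ennreal_times_divide mult.commute)
  ultimately show ?thesis by simp
qed

text \<open>Without positivity this fails when one infimum is 0 and the other one is over the empty set.\<close>

lemma le_INF_mult_INF_ennreal:
  fixes f :: "'a \<Rightarrow> ennreal" and g :: "'b \<Rightarrow> ennreal"
  assumes le: "\<And>a b. a \<in> S \<Longrightarrow> b \<in> T \<Longrightarrow> c \<le> f a * g b"
    and S: "0 < (INF a\<in>S. f a)" and T: "0 < (INF b\<in>T. g b)"
  shows "c \<le> (INF a\<in>S. f a) * (INF b\<in>T. g b)"
proof -
  \<comment> \<open>Take the infimum over \<open>T\<close> first, with \<open>a\<close> fixed. The
    factors are swapped so that the one-variable lemma can be used again for
    \<open>S\<close>.\<close>
  have "c \<le> (INF b\<in>T. g b) * f a" if "a \<in> S" for a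
  proof -
    have "0 < f a"
      using S INF_lower[OF that] by (rule less_le_trans)
    then show ?thesis
      using le that T by (subst mult.commute) (auto intro: le_mult_INF_ennreal)
  qed
  then show ?thesis
    using S T by (subst mult.commute) (rule le_mult_INF_ennreal)
qed

theorem proposition8p1:
  fixes A :: "real ^ 'm ^ 'm" and B :: "real ^ 'n ^ 'n"
    and X :: "'a set" and K :: "'a \<Rightarrow> 'a \<Rightarrow> real"
  assumes "symmetric_stochastic A" and "symmetric_stochastic B" and "kernel_on X K"
  shows "gamma_plus X (kronecker A B) K \<le> gamma_plus X A K * gamma_plus X B K"
proof (cases "\<forall>x\<in>X. \<forall>y\<in>X. K x y = 0")
  case True
  then show ?thesis by (simp add: gamma_plus_eq_0)
next
  case False
  then obtain x y where xy: "x \<in> X" "y \<in> X" "0 < K x y"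
    using assms(3) by (force simp: kernel_on_def)
  have "gamma_plus X (kronecker A B) K \<le> ennreal a * ennreal b"
    if "admissible X A K a" "admissible X B K b" for a b
  proof -
    have "admissible X (kronecker A B) K (a * b)"
      using that assms(2) by (auto intro!: admissible_kronecker simp: symmetric_stochastic_def)
    then have "gamma_plus X (kronecker A B) K \<le> ennreal (a * b)"
      unfolding gamma_plus_eq_INF by (auto intro: INF_lower)
    also have "\<dots> = ennreal a * ennreal b"
      using that by (simp add: admissible_def ennreal_mult)
    finally show ?thesis .
  qed
  \<comment> \<open>Positivity of both infima excludes the product of 0 and \<infinity>.\<close>
  moreover have "0 < gamma_plus X A K" "0 < gamma_plus X B K"
    using assms xy by (auto intro: less_le_trans[OF zero_less_one] gamma_plus_ge_1)
  ultimately show ?thesis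
    unfolding gamma_plus_eq_INF[of X A K] gamma_plus_eq_INF[of X B K]
    by (intro le_INF_mult_INF_ennreal) auto
qed

end
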